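(* For every $m\in\mathbb{N}$ with $m\le 5$ and every $n\in\mathbb{N}$, $\mu(n,m)=U(n,m)$.
   Context: $\mathbb{F}_2$ is the field with two elements. For $u\in\mathbb{F}_2^n$, $|u|$ is the number of entries of $u$ equal to $1$. For an $n\times n$ matrix $W$ over $\mathbb{F}_2$, $M(W,0)=\max\{|Wx| : x\in\mathbb{F}_2^n\}$. For $n,m\ge 1$, $A(n,m)$ is the set of $n\times n$ matrices over $\mathbb{F}_2$ with all diagonal entries $1$ and every column containing at most $m$ ones, and $\mu(n,m)=\min\{M(W,0):W\in A(n,m)\}$. The sequence $(a(n))_{n\ge1}$ is defined by $a(1)=1$; $a(2^k-1+i)=2^{k-1}+a(i)$ for $1\le i\le 2^k-1$, $k\in\mathbb{N}$; and $a(2^{k+1}-1)=2^k$ for $k\in\mathbb{N}$. For $n,m\in\mathbb{N}$, let $k\ge0$ be the integer with $2^k\le m<2^{k+1}$, and let $q\ge 0$ and $1\le r\le 2^{k+1}-1$ be the integers with $n=(2^{k+1}-1)q+r$; then $U(n,m)=q2^k+a(r)$. *)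

theory Defs
  imports
    "Jordan_Normal_Form.Matrix"
    "HOL-Library.Z2"
    "HOL-Library.Discrete_Functions"
begin

definition weight :: "bit vec \<Rightarrow> nat" where
  "weight u = card {i. i < dim_vec u \<and> u $ i = 1}"

text \<open>The quantity \<open>M(W,0)\<close>.\<close>

definition M0 :: "bit mat \<Rightarrow> nat" where
  "M0 W = Max {weight (W *\<^sub>v x) | x. x \<in> carrier_vec (dim_col W)}"

definition A_set :: "nat \<Rightarrow> nat \<Rightarrow> bit mat set" where
  "A_set n m = {W \<in> carrier_mat n n.
     (\<forall>i<n. W $$ (i, i) = 1) \<and> (\<forall>j<n. weight (col W j) \<le> m)}"

definition \<mu> :: "nat \<Rightarrow> nat \<Rightarrow> nat" where
  "\<mu> n m = Min {M0 W | W. W \<in> A_set n m}"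

text \<open>The maximum and the minimum above range over finite nonempty sets
  (the latter for \<open>m \<ge> 1\<close>).\<close>

lemma weight_le: "weight u \<le> dim_vec u"
proof -
  have "card {i. i < dim_vec u \<and> u $ i = 1} \<le> card {..<dim_vec u}"
    by (rule card_mono) auto
  then show ?thesis by (simp add: weight_def)
qed

lemma finite_M0_set: "finite {weight (W *\<^sub>v x) | x. x \<in> carrier_vec (dim_col W)}"
proof (rule finite_subset)
  show "{weight (W *\<^sub>v x) | x. x \<in> carrier_vec (dim_col W)} \<subseteq> {..dim_row W}"
    by (auto intro: order_trans[OF weight_le])
qed simp

lemma nonempty_M0_set: "{weight (W *\<^sub>v x) | x. x \<in> carrier_vec (dim_col W)} \<noteq> {}"
  using zero_carrier_vec by blast

lemma M0_le: "M0 W \<le> dim_row W"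
  unfolding M0_def
  by (subst Max_le_iff[OF finite_M0_set nonempty_M0_set]) (auto intro: order_trans[OF weight_le])

lemma finite_\<mu>_set: "finite {M0 W | W. W \<in> A_set n m}"
proof (rule finite_subset)
  show "{M0 W | W. W \<in> A_set n m} \<subseteq> {..n}"
    by (auto simp: A_set_def intro: order_trans[OF M0_le])
qed simp

lemma nonempty_\<mu>_set:
  assumes "m \<ge> 1"
  shows "{M0 W | W. W \<in> A_set n m} \<noteq> {}"
proof -
  have "weight (col (1\<^sub>m n) j) \<le> m" if "j < n" for j
  proof -
    have "{i. i < n \<and> (1\<^sub>m n :: bit mat) $$ (i, j) = 1} = {j}"
      using that by (auto split: if_splits)
    then have "weight (col (1\<^sub>m n) j) = 1"
      using that by (simp add: weight_def cong: conj_cong)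
    then show ?thesis using assms by simp
  qed
  then have "1\<^sub>m n \<in> A_set n m" by (auto simp: A_set_def)
  then show ?thesis by blast
qed

text \<open>The value at \<open>0\<close> is a dummy: the sequence starts at index \<open>1\<close>.\<close>

function a_seq :: "nat \<Rightarrow> nat" where
  "a_seq 0 = 0"
| "a_seq 1 = 1"
| "1 \<le> k \<Longrightarrow> 1 \<le> i \<Longrightarrow> i \<le> 2 ^ k - 1 \<Longrightarrow> a_seq (2 ^ k - 1 + i) = 2 ^ (k - 1) + a_seq i"
| "1 \<le> k \<Longrightarrow> a_seq (2 ^ (k + 1) - 1) = 2 ^ k"
proof -
  have log3: "floor_log (2 ^ k - 1 + i) = k" if "1 \<le> i" "i \<le> 2 ^ k - 1" for k i :: nat
    by (rule floor_log_eqI) (use that in simp_all)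
  have log4: "floor_log (2 ^ (k + 1) - 1) = k" for k :: nat
  proof (rule floor_log_eqI)
    have "1 \<le> (2::nat) ^ k" by simp
    then show "2 ^ k \<le> (2 ^ (k + 1) - 1 :: nat)" "(2 ^ (k + 1) - 1 :: nat) < 2 * 2 ^ k"
      "0 < (2 ^ (k + 1) - 1 :: nat)"
      by (simp_all only: power_add power_one_right)
  qed
  have ge2: "2 \<le> (2::nat) ^ k" if "1 \<le> k" for k :: nat
    using power_increasing[of 1 k "2::nat"] that by simp
  {
    fix P :: bool and x :: nat
    assume 1: "x = 0 \<Longrightarrow> P" and 2: "x = 1 \<Longrightarrow> P"
      and 3: "\<And>k i. 1 \<le> k \<Longrightarrow> 1 \<le> i \<Longrightarrow> i \<le> 2 ^ k - 1 \<Longrightarrow> x = 2 ^ k - 1 + i \<Longrightarrow> P"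
      and 4: "\<And>k. 1 \<le> k \<Longrightarrow> x = 2 ^ (k + 1) - 1 \<Longrightarrow> P"
    show P
    proof (cases "x \<le> 1")
      case True
      then show ?thesis using 1 2 by linarith
    next
      case False
      define k where "k = floor_log x"
      have k: "1 \<le> k" using False unfolding k_def by (subst floor_log_rec) auto
      have le: "2 ^ k \<le> x" and gt: "x < 2 * 2 ^ k"
        using False floor_log_exp2_le[of x] floor_log_exp2_gt[of x] by (auto simp: k_def)
      show ?thesis
      proof (cases "x = 2 ^ (k + 1) - 1")
        case True
        then show ?thesis using 4 k by blast
      next
        case False
        then show ?thesis
          using 3[of k "x - (2 ^ k - 1)"] k le gt ge2[OF k] by simp
      qed
    qed
  next
    fix k i k' i' :: nat
    assume h: "1 \<le> i" "i \<le> 2 ^ k - 1" "1 \<le> i'" "i' \<le> 2 ^ k' - 1"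
      and eq: "2 ^ k - 1 + i = 2 ^ k' - 1 + i'"
    have "k = k'" using log3 h eq by metis
    moreover have "i = i'" using eq unfolding \<open>k = k'\<close> by (rule add_left_imp_eq)
    ultimately show "2 ^ (k - 1) + a_seq_sumC i = 2 ^ (k' - 1) + a_seq_sumC i'" by simp
  next
    fix k i k' :: nat
    assume h: "1 \<le> i" "i \<le> 2 ^ k - 1" and eq: "2 ^ k - 1 + i = 2 ^ (k' + 1) - 1"
    have "k = k'" using log3 log4 h eq by metis
    with eq h have False by simp
    then show "2 ^ (k - 1) + a_seq_sumC i = 2 ^ k'" by simp
  next
    fix k k' :: nat
    assume "(2::nat) ^ (k + 1) - 1 = 2 ^ (k' + 1) - 1"
    then have "k = k'" using log4 by metis
    then show "(2::nat) ^ k = 2 ^ k'" by simp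
  next
    fix k i :: nat
    assume "1 \<le> k" "1 \<le> i" "1 = 2 ^ k - 1 + i"
    then show "1 = 2 ^ (k - 1) + a_seq_sumC i" using ge2[of k] by simp
  next
    fix k :: nat
    assume "1 \<le> k" "1 = (2::nat) ^ (k + 1) - 1"
    then show "1 = (2::nat) ^ k" using ge2[of k] by simp
  next
    fix k i :: nat
    assume "1 \<le> i" "0 = 2 ^ k - 1 + i"
    then show "0 = 2 ^ (k - 1) + a_seq_sumC i" by simp
  next
    fix k :: nat
    assume "0 = (2::nat) ^ (k + 1) - 1"
    moreover have "(2::nat) ^ (k + 1) > 1" by (rule one_less_power) simp_all
    ultimately show "0 = (2::nat) ^ k" by simp
  }
qed simp_all
termination
proof (relation "measure id")
  fix k i :: nat
  assume "1 \<le> k"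
  then show "(i, 2 ^ k - 1 + i) \<in> measure id"
    using power_increasing[of 1 k "2::nat"] by simp
qed simp

text \<open>\<open>U_eq\<close> below states the usual characterization of \<open>k\<close>, \<open>q\<close> and \<open>r\<close>.\<close>

definition U :: "nat \<Rightarrow> nat \<Rightarrow> nat" where
  "U n m =
    (let k = floor_log m;
         q = (n - 1) div (2 ^ (k + 1) - 1);
         r = n - (2 ^ (k + 1) - 1) * q
     in q * 2 ^ k + a_seq r)"

lemma U_eq:
  assumes "2 ^ k \<le> m" "m < 2 ^ (k + 1)"
    and "1 \<le> r" "r \<le> 2 ^ (k + 1) - 1" "n = (2 ^ (k + 1) - 1) * q + r"
  shows "U n m = q * 2 ^ k + a_seq r"
proof -
  define N :: nat where "N = 2 ^ (k + 1) - 1"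
  have k: "floor_log m = k"
    by (rule floor_log_eqI) (use assms in \<open>auto intro: Suc_le_lessD order.strict_trans2\<close>)
  have n1: "n - 1 = N * q + (r - 1)" and r: "r - 1 < N"
    using assms by (auto simp: N_def)
  have "(n - 1) div N = q" unfolding n1 using r by simp
  moreover have "n - N * q = r" using assms(5) by (simp add: N_def)
  ultimately show ?thesis by (simp add: U_def k Let_def N_def)
qed

end

theory Submission
  imports Defs
begin

text \<open>
  Vectors over the field with two elements are treated as sets with symmetric difference; the column
  space of \<open>W\<close> is a span of sets that cover all coordinates and have at most \<open>m\<close> elements each.
  For the lower bound one repeatedly splits off a set \<open>T\<close> of coordinates such that every member of
  the span can be corrected, by a member supported in \<open>T\<close>, to have at least \<open>s\<close> ones in \<open>T\<close>; the
  pair \<open>(|T|, s)\<close> has to be at least as good as the increments of \<open>U\<close>. Such a correction exists by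
  averaging over the members supported in \<open>T\<close>: the average is \<open>|T| / 2\<close>, and parity arguments
  improve on it. For \<open>m \<le> 5\<close> irreducibility forces, step by step, that there are no generators
  of size 5, then none of size 2, then none of size 4.
  The upper bound comes from direct sums of simplex codes of lengths 1, 3 and 7.
\<close>

section \<open>Spans of sets under symmetric difference\<close>

definition xor :: "'a set \<Rightarrow> 'a set \<Rightarrow> 'a set" (infixl "\<triangle>" 65) where
  "A \<triangle> B = (A - B) \<union> (B - A)"

lemma in_xor [simp]: "x \<in> A \<triangle> B \<longleftrightarrow> (x \<in> A) \<noteq> (x \<in> B)"
  by (auto simp: xor_def)

lemma xor_empty [simp]: "{} \<triangle> A = A" "A \<triangle> {} = A"
  by auto

lemma xor_cancel [simp]: "A \<triangle> (A \<triangle> B) = B" "A \<triangle> A = {}"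
  by auto

lemma xor_assoc: "A \<triangle> B \<triangle> C = A \<triangle> (B \<triangle> C)"
  by auto

lemma finite_xor [simp]: "finite A \<Longrightarrow> finite B \<Longrightarrow> finite (A \<triangle> B)"
  by (simp add: xor_def)

lemma card_xor:
  assumes "finite A" "finite B"
  shows "card (A \<triangle> B) + 2 * card (A \<inter> B) = card A + card B"
proof -
  have 1: "card (A \<triangle> B) = card (A - B) + card (B - A)"
    unfolding xor_def by (rule card_Un_disjoint) (use assms in auto)
  have 2: "card A = card (A \<inter> B) + card (A - B)" "card B = card (A \<inter> B) + card (B - A)"
    using card_Int_Diff[OF assms(1), of B] card_Int_Diff[OF assms(2), of A]
    by (simp_all add: Int_commute)
  show ?thesis using 1 2 by simp
qed

inductive_set xor_span :: "'a set set \<Rightarrow> 'a set set" for G where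
  empty: "{} \<in> xor_span G"
| step: "A \<in> G \<Longrightarrow> X \<in> xor_span G \<Longrightarrow> A \<triangle> X \<in> xor_span G"

lemma xor_span_base: "A \<in> G \<Longrightarrow> A \<in> xor_span G"
  using xor_span.step[OF _ xor_span.empty] by force

lemma xor_span_xor:
  assumes "A \<in> xor_span G" "B \<in> xor_span G"
  shows "A \<triangle> B \<in> xor_span G"
  using assms
  by (induction A rule: xor_span.induct) (auto simp: xor_assoc intro: xor_span.step)

lemma xor_span_subset_Union: "A \<in> xor_span G \<Longrightarrow> A \<subseteq> \<Union>G"
  by (induction rule: xor_span.induct) (auto simp: subset_iff)

lemma xor_span_minimal:
  assumes "F \<subseteq> xor_span G"
  shows "xor_span F \<subseteq> xor_span G"
proof
  fix X assume "X \<in> xor_span F"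
  then show "X \<in> xor_span G"
    by induction (use assms in \<open>auto intro: xor_span.empty xor_span_xor\<close>)
qed

lemma finite_xor_span: "finite (\<Union>G) \<Longrightarrow> finite (xor_span G)"
  by (rule finite_subset[of _ "Pow (\<Union>G)"]) (auto dest: xor_span_subset_Union)

text \<open>Restriction to \<open>S\<close> is additive, so it maps the span onto the span of the
  restricted generators. This lifts a member found on the remaining coordinates back to the full
  span.\<close>

lemma xor_span_trace: "X \<in> xor_span ((\<lambda>A. A \<inter> S) ` G) \<Longrightarrow> \<exists>Y\<in>xor_span G. X = Y \<inter> S"
proof (induction rule: xor_span.induct)
  case empty
  then show ?case using xor_span.empty by blast
next
  case (step A X)
  then obtain B Y where "B \<in> G" "A = B \<inter> S" "Y \<in> xor_span G" "X = Y \<inter> S" by auto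
  then have "B \<triangle> Y \<in> xor_span G" "A \<triangle> X = (B \<triangle> Y) \<inter> S" by (auto intro: xor_span.step)
  then show ?case by blast
qed

section \<open>Averages over a span, and splitting off coordinates\<close>

lemma card_Int_eq_sum: "finite T \<Longrightarrow> card (T \<inter> A) = (\<Sum>p\<in>T. of_bool (p \<in> A))"
  by (simp add: Int_def)

text \<open>Adding a fixed member that contains \<open>p\<close> is an involution of the span which changes whether
  \<open>p\<close> belongs to \<open>u \<triangle> e\<close>, so exactly half of the members \<open>e\<close> put \<open>p\<close> into \<open>u \<triangle> e\<close>.\<close>

lemma xor_span_average:
  assumes fin: "finite (\<Union>E)" and T: "T \<subseteq> \<Union>E"
  shows "(\<Sum>e\<in>xor_span E. 2 * card (T \<inter> (u \<triangle> e))) = card (xor_span E) * card T"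
proof -
  have finT: "finite T" using T fin finite_subset by blast
  have half: "2 * (\<Sum>e\<in>xor_span E. of_bool (p \<in> u \<triangle> e)) = card (xor_span E)" if "p \<in> T" for p
  proof -
    obtain c where c: "c \<in> E" "p \<in> c" using T \<open>p \<in> T\<close> by blast
    have cs: "c \<in> xor_span E" using c(1) by (rule xor_span_base)
    have "(\<Sum>e\<in>xor_span E. of_bool (p \<in> u \<triangle> e)) = (\<Sum>e\<in>xor_span E. of_bool (p \<notin> u \<triangle> e) :: nat)"
      by (rule sum.reindex_bij_witness[of _ "\<lambda>e. c \<triangle> e" "\<lambda>e. c \<triangle> e"])
        (use c cs in \<open>auto intro: xor_span_xor\<close>)
    then have "2 * (\<Sum>e\<in>xor_span E. of_bool (p \<in> u \<triangle> e)) =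
        (\<Sum>e\<in>xor_span E. of_bool (p \<in> u \<triangle> e) + of_bool (p \<notin> u \<triangle> e) :: nat)"
      by (simp add: sum.distrib)
    also have "\<dots> = (\<Sum>e\<in>xor_span E. 1)" by (rule sum.cong) auto
    finally show ?thesis by simp
  qed
  have "(\<Sum>e\<in>xor_span E. 2 * card (T \<inter> (u \<triangle> e))) =
      (\<Sum>e\<in>xor_span E. \<Sum>p\<in>T. 2 * of_bool (p \<in> u \<triangle> e))"
    by (simp add: card_Int_eq_sum[OF finT] sum_distrib_left)
  also have "\<dots> = (\<Sum>p\<in>T. \<Sum>e\<in>xor_span E. 2 * of_bool (p \<in> u \<triangle> e))" by (rule sum.swap)
  also have "\<dots> = (\<Sum>p\<in>T. card (xor_span E))"
    by (rule sum.cong) (simp_all only: half sum_distrib_left[symmetric])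
  finally show ?thesis by simp
qed

lemma xor_span_average_ge:
  assumes "finite (\<Union>E)" "T \<subseteq> \<Union>E"
  obtains e where "e \<in> xor_span E" "card T \<le> 2 * card (T \<inter> (u \<triangle> e))"
proof (rule ccontr)
  assume "\<not> thesis"
  then have "\<forall>e\<in>xor_span E. 2 * card (T \<inter> (u \<triangle> e)) < card T" using that by fastforce
  then have "(\<Sum>e\<in>xor_span E. 2 * card (T \<inter> (u \<triangle> e))) < (\<Sum>e\<in>xor_span E. card T)"
    using xor_span.empty by (intro sum_strict_mono finite_xor_span assms) auto
  then show False by (simp add: xor_span_average[OF assms])
qed

text \<open>Values that never exceed their average all equal it.\<close>

lemma xor_span_average_eq:
  assumes "finite (\<Union>E)" "T \<subseteq> \<Union>E" "\<forall>e\<in>xor_span E. 2 * card (T \<inter> (u \<triangle> e)) \<le> card T"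
    and "e \<in> xor_span E"
  shows "2 * card (T \<inter> (u \<triangle> e)) = card T"
proof (rule ccontr)
  assume "2 * card (T \<inter> (u \<triangle> e)) \<noteq> card T"
  then have "2 * card (T \<inter> (u \<triangle> e)) < card T" using assms by force
  then have "(\<Sum>e\<in>xor_span E. 2 * card (T \<inter> (u \<triangle> e))) < (\<Sum>e\<in>xor_span E. card T)"
    using assms by (intro sum_strict_mono_ex1 finite_xor_span) auto
  then show False by (simp add: xor_span_average[OF assms(1,2)])
qed

text \<open>Adding \<open>d\<close> changes nothing outside \<open>T\<close>, so \<open>s\<close>
  ones on \<open>T\<close> are guaranteed whatever has been achieved on the other coordinates.
  Nonemptiness of \<open>T\<close> makes the recursion in \<open>exists_heavy\<close>
  terminate.\<close>

definition reducible :: "'a set set \<Rightarrow> 'a set \<Rightarrow> nat \<Rightarrow> bool" where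
  "reducible G T s \<longleftrightarrow> T \<noteq> {} \<and> T \<subseteq> \<Union>G \<and>
     (\<forall>y\<in>xor_span G. \<exists>d\<in>xor_span G. d \<subseteq> T \<and> s \<le> card (T \<inter> (y \<triangle> d)))"

text \<open>Induction on the number of coordinates: delete \<open>T\<close> from all generators,
  take a heavy member of the smaller span, lift it to the span of \<open>G\<close>, and correct it
  on \<open>T\<close>. The pairs in \<open>P\<close> are those for which the \<open>s\<close> ones
  gained make up for the decrease of the bound \<open>g\<close>.\<close>

lemma exists_heavy:
  fixes P :: "(nat \<times> nat) set" and g :: "nat \<Rightarrow> nat"
  assumes local: "\<And>G :: 'a set set. finite (\<Union>G) \<Longrightarrow> \<Union>G \<noteq> {} \<Longrightarrow> \<forall>A\<in>G. card A \<le> m \<Longrightarrow>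
      \<exists>T s. reducible G T s \<and> (card T, s) \<in> P"
    and gain: "\<And>n t s. (t, s) \<in> P \<Longrightarrow> t \<le> n \<Longrightarrow> g n \<le> g (n - t) + s"
    and g0: "g 0 = 0"
    and fin: "finite (\<Union>G)" and le: "\<forall>A\<in>G. card A \<le> m"
  shows "\<exists>y\<in>xor_span (G :: 'a set set). g (card (\<Union>G)) \<le> card y"
  using fin le
proof (induction "card (\<Union>G)" arbitrary: G rule: less_induct)
  case less
  show ?case
  proof (cases "\<Union>G = {}")
    case True
    then show ?thesis using g0 by (intro bexI[OF _ xor_span.empty]) (simp only: True card.empty)
  next
    case False
    then obtain T s where red: "reducible G T s" and P: "(card T, s) \<in> P"
      using local[OF less.prems(1) False less.prems(2)] by blast
    have T: "T \<noteq> {}" "T \<subseteq> \<Union>G" using red by (auto simp: reducible_def)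
    have finT: "finite T" using T less.prems finite_subset by blast
    define H where "H = (\<lambda>A. A \<inter> (-T)) ` G"
    have UH: "\<Union>H = \<Union>G - T" by (auto simp: H_def)
    have cUH: "card (\<Union>H) = card (\<Union>G) - card T" unfolding UH
      using finT T(2) by (rule card_Diff_subset)
    have "card (\<Union>H) < card (\<Union>G)"
      unfolding UH using T less.prems by (intro psubset_card_mono) auto
    moreover have "finite (\<Union>H)" unfolding UH using less.prems by simp
    moreover have "\<forall>A\<in>H. card A \<le> m"
    proof
      fix A assume "A \<in> H"
      then obtain B where B: "B \<in> G" "A = B \<inter> (-T)" by (auto simp: H_def)
      have "finite B" using B less.prems(1) by (meson Union_upper finite_subset)
      then have "card A \<le> card B" using B by (intro card_mono) auto
      then show "card A \<le> m" using B less.prems(2) by force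
    qed
    ultimately obtain z where z: "z \<in> xor_span H" "g (card (\<Union>H)) \<le> card z"
      using less.hyps by blast
    obtain y where y: "y \<in> xor_span G" "z = y \<inter> (-T)"
      using xor_span_trace z(1) unfolding H_def by blast
    obtain d where d: "d \<in> xor_span G" "d \<subseteq> T" "s \<le> card (T \<inter> (y \<triangle> d))"
      using red y(1) unfolding reducible_def by blast
    have yd: "y \<triangle> d \<in> xor_span G" using y d by (simp add: xor_span_xor)
    have "y \<triangle> d = z \<union> T \<inter> (y \<triangle> d)" using y d by auto
    moreover have "finite z" using y xor_span_subset_Union less.prems(1)
      by (metis finite_Int finite_subset)
    ultimately have "card (y \<triangle> d) = card z + card (T \<inter> (y \<triangle> d))"
      using y finT by (subst card_Un_disjoint[symmetric]) auto
    moreover have "g (card (\<Union>G)) \<le> g (card (\<Union>G) - card T) + s"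
      by (rule gain[OF P]) (use T less.prems in \<open>auto intro: card_mono\<close>)
    ultimately have "g (card (\<Union>G)) \<le> card (y \<triangle> d)" using z d cUH by simp
    then show ?thesis using yd by blast
  qed
qed

text \<open>Some correction from the span of \<open>F\<close> reaches the average, which is half of
  \<open>card (\<Union>F)\<close> and may be rounded up. \<open>F\<close> may consist of arbitrary
  members of the span, not only of generators.\<close>

lemma reducible_average:
  assumes "finite (\<Union>G)" "F \<subseteq> xor_span G" "\<Union>F \<noteq> {}"
  shows "reducible G (\<Union>F) ((card (\<Union>F) + 1) div 2)"
  unfolding reducible_def
proof (intro conjI ballI)
  have sub: "\<Union>F \<subseteq> \<Union>G" using assms xor_span_subset_Union by blast
  then show "\<Union>F \<subseteq> \<Union>G" .
  fix y
  obtain e where e: "e \<in> xor_span F" "card (\<Union>F) \<le> 2 * card (\<Union>F \<inter> (y \<triangle> e))"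
    by (rule xor_span_average_ge[of F "\<Union>F"]) (use sub assms in \<open>auto intro: finite_subset\<close>)
  then show "\<exists>d\<in>xor_span G. d \<subseteq> \<Union>F \<and> (card (\<Union>F) + 1) div 2 \<le> card (\<Union>F \<inter> (y \<triangle> d))"
    using xor_span_minimal[OF assms(2)] xor_span_subset_Union[of e F] by (intro bexI[of _ e]) auto
qed (use assms in simp)

text \<open>If no member did better than the average, then all members would meet it exactly, which
  forces the span to be self-orthogonal.\<close>

lemma reducible_even:
  assumes "finite (\<Union>G)" "F \<subseteq> xor_span G" "\<Union>F \<noteq> {}" "even (card (\<Union>F))"
    and ab: "a \<in> F" "b \<in> F" "odd (card (a \<inter> b))"
  shows "reducible G (\<Union>F) (card (\<Union>F) div 2 + 1)"
  unfolding reducible_def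
proof (intro conjI ballI)
  let ?T = "\<Union>F"
  have sub: "?T \<subseteq> \<Union>G" using assms xor_span_subset_Union by blast
  then show "?T \<subseteq> \<Union>G" .
  have fin: "finite ?T" using sub assms finite_subset by blast
  fix y
  have "\<exists>e\<in>xor_span F. card ?T < 2 * card (?T \<inter> (y \<triangle> e))"
  proof (rule ccontr)
    assume "\<not> ?thesis"
    then have eq: "2 * card (?T \<inter> (y \<triangle> e)) = card ?T" if "e \<in> xor_span F" for e
      using xor_span_average_eq[OF fin order_refl _ that] by (simp add: not_less)
    \<comment> \<open>Comparing the exact values at \<open>e\<close> and at \<open>{}\<close> shows
      that \<open>y\<close> contains exactly half of every member \<open>e\<close>.\<close>
    have half: "card e = 2 * card (?T \<inter> y \<inter> e)" if e: "e \<in> xor_span F" for e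
    proof -
      have eT: "e \<subseteq> ?T" using xor_span_subset_Union[OF e] .
      have "?T \<inter> (y \<triangle> e) = (?T \<inter> y) \<triangle> e" using eT by (auto simp: subset_iff)
      then show ?thesis
        using eq[OF e] eq[OF xor_span.empty] card_xor[of "?T \<inter> y" e] fin eT
        by (simp add: finite_subset)
    qed
    have s: "a \<in> xor_span F" "b \<in> xor_span F" using ab by (auto intro: xor_span_base)
    have f: "finite a" "finite b" using ab fin by (meson Union_upper finite_subset)+
    \<comment> \<open>Halving \<open>a\<close>, \<open>b\<close> and \<open>a \<triangle> b\<close>
      at once forces \<open>y\<close> to halve \<open>a \<inter> b\<close> as well, so this
      intersection is even. The case \<open>a = b\<close> treats a single member of odd
      size.\<close>
    have "?T \<inter> y \<inter> (a \<triangle> b) = (?T \<inter> y \<inter> a) \<triangle> (?T \<inter> y \<inter> b)" by auto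
    then have "card (a \<inter> b) = 2 * card ((?T \<inter> y \<inter> a) \<inter> (?T \<inter> y \<inter> b))"
      using half[OF s(1)] half[OF s(2)] half[OF xor_span_xor[OF s]]
        card_xor[of "?T \<inter> y \<inter> a" "?T \<inter> y \<inter> b"] card_xor[of a b] f by simp
    then show False using ab(3) by simp
  qed
  then obtain e where e: "e \<in> xor_span F" "card ?T < 2 * card (?T \<inter> (y \<triangle> e))" by blast
  then have "card ?T div 2 + 1 \<le> card (?T \<inter> (y \<triangle> e))" using assms(4) by presburger
  then show "\<exists>d\<in>xor_span G. d \<subseteq> ?T \<and> card ?T div 2 + 1 \<le> card (?T \<inter> (y \<triangle> d))"
    using e xor_span_minimal[OF assms(2)] xor_span_subset_Union[of e F]
    by (intro bexI[of _ e]) auto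
qed (use assms in simp)

lemma even_card_xor:
  "finite A \<Longrightarrow> finite B \<Longrightarrow> even (card (A \<triangle> B)) \<longleftrightarrow> (even (card A) \<longleftrightarrow> even (card B))"
  using card_xor[of A B] by presburger

text \<open>The even members of the span still cover \<open>\<Union>F\<close>, so the average of the two cosets of the even
  part is the same, and one of the cosets has the parity that excludes the value just above it.\<close>

lemma reducible_odd:
  assumes "finite (\<Union>G)" "F \<subseteq> xor_span G" "odd (card (\<Union>F))"
    and oddF: "\<forall>A\<in>F. odd (card A)" and "\<Inter>F = {}"
  shows "reducible G (\<Union>F) ((card (\<Union>F) + 3) div 2)"
  unfolding reducible_def
proof (intro conjI ballI)
  let ?T = "\<Union>F"
  have ne: "?T \<noteq> {}" using assms(3) card.empty by fastforce
  then show "?T \<noteq> {}" .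
  have sub: "?T \<subseteq> \<Union>G" using assms xor_span_subset_Union by blast
  then show "?T \<subseteq> \<Union>G" .
  have fin: "finite ?T" using sub assms finite_subset by blast
  have finF: "finite A" if "A \<in> F" for A using that fin by (meson Union_upper finite_subset)
  obtain c where c: "c \<in> F" using ne by auto
  define E where "E = {A \<triangle> B | A B. A \<in> F \<and> B \<in> F}"
  have EG: "E \<subseteq> xor_span F" by (auto simp: E_def intro: xor_span_xor xor_span_base)
  have UE: "\<Union>E = ?T"
  proof
    show "\<Union>E \<subseteq> ?T" by (auto simp: E_def)
    show "?T \<subseteq> \<Union>E"
    proof
      fix p assume "p \<in> ?T"
      then obtain A where A: "A \<in> F" "p \<in> A" by auto
      obtain B where B: "B \<in> F" "p \<notin> B" using assms(5) by auto
      have "A \<triangle> B \<in> E" "p \<in> A \<triangle> B" using A B by (auto simp: E_def)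
      then show "p \<in> \<Union>E" by blast
    qed
  qed
  have evE: "even (card e) \<and> finite e" if "e \<in> xor_span E" for e
    using that
  proof induction
    case (step A X)
    then have "even (card A) \<and> finite A" using oddF finF by (auto simp: E_def even_card_xor)
    then show ?case using step by (simp add: even_card_xor)
  qed simp
  fix y
  define k where "k = card ?T div 2"
  \<comment> \<open>Adding the odd set \<open>c\<close> changes the parity on \<open>T\<close>, so
    \<open>u\<close> can be chosen to meet \<open>T\<close> in a number congruent to
    \<open>k\<close> modulo 2, and even corrections preserve this. As
    \<open>card T = 2 * k + 1\<close>, the average yields at least \<open>k + 1\<close>, hence at
    least \<open>k + 2\<close>.\<close>
  define u where "u = (if even (card (?T \<inter> y)) = even k then y else y \<triangle> c)"
  have par_u: "even (card (?T \<inter> u)) = even k"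
  proof -
    have "?T \<inter> (y \<triangle> c) = (?T \<inter> y) \<triangle> c" using c by auto
    then show ?thesis using c oddF finF fin by (auto simp: u_def even_card_xor)
  qed
  obtain e where e: "e \<in> xor_span E" "card ?T \<le> 2 * card (?T \<inter> (u \<triangle> e))"
    by (rule xor_span_average_ge[of E ?T]) (use fin UE in auto)
  have "e \<subseteq> ?T" using xor_span_subset_Union[OF e(1)] UE by simp
  then have "?T \<inter> (u \<triangle> e) = (?T \<inter> u) \<triangle> e" by (auto simp: subset_iff)
  then have "even (card (?T \<inter> (u \<triangle> e))) = even k"
    using evE[OF e(1)] par_u fin by (simp add: even_card_xor)
  then have big: "(card ?T + 3) div 2 \<le> card (?T \<inter> (u \<triangle> e))"
    using e(2) assms(3) unfolding k_def by presburger
  have eF: "e \<in> xor_span F" using e EG xor_span_minimal by blast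
  obtain d where d: "d \<in> xor_span F" "u \<triangle> e = y \<triangle> d"
  proof (cases "u = y")
    case True
    then show ?thesis using that eF by blast
  next
    case False
    then have "u \<triangle> e = y \<triangle> (c \<triangle> e)" by (auto simp: u_def split: if_splits)
    then show ?thesis using that c eF xor_span.step by blast
  qed
  then show "\<exists>d\<in>xor_span G. d \<subseteq> ?T \<and> (card ?T + 3) div 2 \<le> card (?T \<inter> (y \<triangle> d))"
    using big xor_span_minimal[OF assms(2)] xor_span_subset_Union[of d F]
    by (intro bexI[of _ d]) auto
qed

text \<open>No generator crosses the boundary of \<open>T\<close>, so the span is a direct sum and
  contains \<open>T \<inter> y\<close>. The part of \<open>y\<close> inside \<open>T\<close> can
  therefore be exchanged for any prescribed member \<open>z\<close>.\<close>

lemma reducible_isolated: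
  assumes "\<forall>A\<in>G. A \<subseteq> T \<or> A \<inter> T = {}" "z \<in> xor_span G" "z \<subseteq> T" "T \<noteq> {}" "T \<subseteq> \<Union>G"
  shows "reducible G T (card z)"
  unfolding reducible_def
proof (intro conjI ballI assms)
  fix y assume "y \<in> xor_span G"
  then have "T \<inter> y \<in> xor_span G"
  proof induction
    case (step A X)
    show ?case
    proof (cases "A \<subseteq> T")
      case True
      then have "T \<inter> (A \<triangle> X) = A \<triangle> (T \<inter> X)" by auto
      then show ?thesis using step by (simp add: xor_span.step)
    next
      case False
      then have "T \<inter> (A \<triangle> X) = T \<inter> X" using assms(1) step by fastforce
      then show ?thesis using step by simp
    qed
  qed (simp add: xor_span.empty)
  then have "(T \<inter> y) \<triangle> z \<in> xor_span G" using assms(2) by (rule xor_span_xor)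
  moreover have "T \<inter> (y \<triangle> ((T \<inter> y) \<triangle> z)) = z" using assms(3) by auto
  ultimately show "\<exists>d\<in>xor_span G. d \<subseteq> T \<and> card z \<le> card (T \<inter> (y \<triangle> d))"
    using assms(3) by (intro bexI[of _ "(T \<inter> y) \<triangle> z"]) auto
qed

lemma xor_span_homogeneous:
  assumes "\<forall>A\<in>G. P \<subseteq> A \<or> A \<inter> P = {}" "y \<in> xor_span G"
  shows "P \<subseteq> y \<or> y \<inter> P = {}"
  using assms(2)
proof induction
  case (step A X)
  then show ?case using assms(1) by fastforce
qed simp

text \<open>Every member of the span is constant on \<open>B\<close>; adding \<open>B\<close> itself
  turns all zeros there into ones.\<close>

lemma reducible_homogeneous:
  assumes "B \<in> G" "B \<noteq> {}" "\<forall>A\<in>G. B \<subseteq> A \<or> A \<inter> B = {}"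
  shows "reducible G B (card B)"
  unfolding reducible_def
proof (intro conjI ballI)
  fix y assume "y \<in> xor_span G"
  then consider "B \<subseteq> y" | "y \<inter> B = {}" using xor_span_homogeneous[OF assms(3)] by blast
  then show "\<exists>d\<in>xor_span G. d \<subseteq> B \<and> card B \<le> card (B \<inter> (y \<triangle> d))"
  proof cases
    case 1
    then have "B \<inter> (y \<triangle> {}) = B" by auto
    then show ?thesis using xor_span.empty by (intro bexI[of _ "{}"]) auto
  next
    case 2
    then have "B \<inter> (y \<triangle> B) = B" by auto
    then show ?thesis using assms xor_span_base[of B G] by (intro bexI[of _ B]) auto
  qed
qed (use assms in auto)

section \<open>Generators with at most five elements\<close>

text \<open>Pairs that do not lose against the bound \<open>g7\<close>, as checked in
  \<open>g7_gain\<close>. Averaging supplies sizes 1, 3, 7; the even criterion 6, 8, 14; the odd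
  criterion 13, 15. The remaining pairs, and (6,4) once more, come from isolated or nearly constant
  sets of coordinates.\<close>

definition gains5 :: "(nat \<times> nat) set" where
  "gains5 = {(1,1), (2,2), (3,2), (4,4), (5,4), (6,4), (7,4), (8,5), (12,8), (13,8), (14,8), (15,9)}"

text \<open>The situation of a counterexample, to be refuted by showing that all generators are
  empty.\<close>

locale irreducible5 =
  fixes G :: "'a set set"
  assumes fin: "finite (\<Union>G)"
    and le5: "A \<in> G \<Longrightarrow> card A \<le> 5"
    and irreducible: "reducible G T s \<Longrightarrow> (card T, s) \<notin> gains5"
begin

lemma finite_span: "A \<in> xor_span G \<Longrightarrow> finite A"
  using xor_span_subset_Union fin finite_subset by metis

lemma finite_gen: "A \<in> G \<Longrightarrow> finite A"
  using finite_span xor_span_base by metis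

section \<open>Forbidden sizes of unions, and the exclusion of generators of size five\<close>

lemma not_1_3_7:
  assumes "F \<subseteq> xor_span G"
  shows "card (\<Union>F) \<notin> {1, 3, 7}"
proof
  assume t: "card (\<Union>F) \<in> {1, 3, 7}"
  then have "\<Union>F \<noteq> {}" by (metis card.empty insertE empty_iff zero_neq_numeral zero_neq_one)
  from irreducible[OF reducible_average[OF fin assms this]] show False
    using t by (auto simp: gains5_def)
qed

lemma not_6_8_14:
  assumes "F \<subseteq> xor_span G" "a \<in> F" "b \<in> F" "odd (card (a \<inter> b))"
  shows "card (\<Union>F) \<notin> {6, 8, 14}"
proof
  assume t: "card (\<Union>F) \<in> {6, 8, 14}"
  then have 1: "\<Union>F \<noteq> {}" by (metis card.empty insertE empty_iff zero_neq_numeral)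
  have 2: "even (card (\<Union>F))" using t by auto
  from irreducible[OF reducible_even[OF fin assms(1) 1 2 assms(2-4)]] show False
    using t by (auto simp: gains5_def)
qed

lemma not_13_15:
  assumes "F \<subseteq> xor_span G" "\<forall>A\<in>F. odd (card A)" "\<Inter>F = {}"
  shows "card (\<Union>F) \<notin> {13, 15}"
proof
  assume t: "card (\<Union>F) \<in> {13, 15}"
  then have "odd (card (\<Union>F))" by auto
  from irreducible[OF reducible_odd[OF fin assms(1) this assms(2-3)]] show False
    using t by (auto simp: gains5_def)
qed

text \<open>If \<open>d\<close> lay inside \<open>c\<close>, then \<open>d\<close> or its complement
  in \<open>c\<close> would have size 1 or 3. If \<open>d\<close> added 1, 2 or 3 points to
  \<open>c\<close>, the union would have size 6, 7 or 8; sizes 6 and 8 are excluded because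
  \<open>c\<close> is odd. So \<open>d\<close> adds at least four points and has room for only one
  common point.\<close>

lemma meet_5:
  assumes c: "c \<in> G" "card c = 5" and d: "d \<in> G" "d \<inter> c \<noteq> {}" "d \<noteq> c"
  shows "card d = 5" "card (d \<inter> c) = 1"
proof -
  have f: "finite c" "finite d" using c d finite_gen by auto
  have s: "c \<in> xor_span G" "d \<in> xor_span G" using c d xor_span_base by auto
  have int: "card (d \<inter> c) > 0" using f d by (simp add: card_gt_0_iff)
  have cd: "card d = card (d \<inter> c) + card (d - c)" by (rule card_Int_Diff) (use f in simp)
  have un: "card (c \<union> d) = 5 + card (d - c)"
    using card_Un_disjoint[of c "d - c"] f c by simp
  have "card (d - c) \<noteq> 0"
  proof
    assume "card (d - c) = 0"
    then have sub: "d \<subseteq> c" using f by simp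
    then have "card d < 5" using psubset_card_mono[of c d] d c f by auto
    moreover have "card (c \<triangle> d) + card d = 5"
      using card_xor[of c d] f c cd sub by (simp add: Int_absorb1)
    moreover have "card d > 0" using int cd by simp
    ultimately show False
      using not_1_3_7[of "{d}"] not_1_3_7[of "{c \<triangle> d}"] s xor_span_xor by force
  qed
  moreover have "card (c \<union> d) \<noteq> 7" using not_1_3_7[of "{c, d}"] s by auto
  moreover have "card (c \<union> d) \<noteq> 6" "card (c \<union> d) \<noteq> 8"
    using not_6_8_14[of "{c, d}" c c] s c by auto
  ultimately have "card (d - c) \<ge> 4" using un by linarith
  then show "card d = 5" "card (d \<inter> c) = 1" using cd int le5[OF d(1)] by linarith+
qed

text \<open>If \<open>e2\<close> and \<open>e3\<close> were disjoint, the three odd sets would have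
  no common point and a union of size 5 + 4 + 4 = 13.\<close>

lemma trans_5:
  assumes "e1 \<in> G" "e2 \<in> G" "e3 \<in> G" "card e1 = 5"
    and "e2 \<inter> e1 \<noteq> {}" "e2 \<noteq> e1" "e3 \<inter> e1 \<noteq> {}" "e3 \<noteq> e1"
  shows "e2 \<inter> e3 \<noteq> {}"
proof
  assume disj: "e2 \<inter> e3 = {}"
  note m2 = meet_5[OF assms(1,4) assms(2,5,6)]
  note m3 = meet_5[OF assms(1,4) assms(3,7,8)]
  have f: "finite e1" "finite e2" "finite e3" using assms finite_gen by auto
  have u2: "card (e1 \<union> e2) = 9"
    using card_Un_Int[OF f(1,2)] m2 assms by (simp add: Int_commute)
  have "(e1 \<union> e2) \<inter> e3 = e3 \<inter> e1" using disj by auto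
  then have "card (e1 \<union> e2 \<union> e3) = 13"
    using card_Un_Int[of "e1 \<union> e2" e3] f u2 m3 by simp
  moreover have "{e1, e2, e3} \<subseteq> xor_span G" using assms xor_span_base by auto
  ultimately show False
    using not_13_15[of "{e1, e2, e3}"] assms m2 m3 disj by (auto simp: Un_assoc)
qed

text \<open>Otherwise every member of the span is constant on \<open>c\<close> apart from
  \<open>x\<close>, and adding \<open>c\<close> where necessary secures four of its five
  coordinates.\<close>

lemma two_points_5:
  assumes c: "c \<in> G" "card c = 5" and x: "x \<in> c"
  shows "\<exists>d\<in>G. d \<noteq> c \<and> \<not> d \<inter> c \<subseteq> {x}"
proof (rule ccontr)
  assume "\<not> ?thesis"
  then have all: "\<forall>d\<in>G. d \<noteq> c \<longrightarrow> d \<inter> c \<subseteq> {x}" by blast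
  have f: "finite c" using c finite_gen by auto
  have "reducible G c 4"
    unfolding reducible_def
  proof (intro conjI ballI)
    show "c \<noteq> {}" "c \<subseteq> \<Union>G" using c by auto
    fix y assume "y \<in> xor_span G"
    then have "y \<inter> c \<subseteq> {x} \<or> c - y \<subseteq> {x}"
    proof induction
      case (step A X)
      show ?case
      proof (cases "A = c")
        case True
        then show ?thesis using step.IH by auto
      next
        case False
        then have "A \<inter> c \<subseteq> {x}" using all step by blast
        then show ?thesis using step.IH by fastforce
      qed
    qed simp
    then have "\<exists>d\<in>{{}, c}. c - {x} \<subseteq> c \<inter> (y \<triangle> d)" by auto
    then obtain d where d: "d \<in> {{}, c}" "c - {x} \<subseteq> c \<inter> (y \<triangle> d)" by blast
    have "card (c - {x}) \<le> card (c \<inter> (y \<triangle> d))" using d f by (intro card_mono) auto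
    then have "4 \<le> card (c \<inter> (y \<triangle> d))" using c x f by simp
    moreover have "d \<in> xor_span G" "d \<subseteq> c" using d c xor_span.empty xor_span_base by auto
    ultimately show "\<exists>d\<in>xor_span G. d \<subseteq> c \<and> 4 \<le> card (c \<inter> (y \<triangle> d))" by blast
  qed
  from irreducible[OF this] show False using c by (simp add: gains5_def)
qed

text \<open>The triangle covers 15 - 3 = 12 coordinates. If it is isolated,
  \<open>c1 \<triangle> c2\<close> provides 8 ones. Otherwise some generator leaves it, and the
  union with that generator has a forbidden size.\<close>

lemma no_triangle_5:
  assumes G: "c1 \<in> G" "c2 \<in> G" "c3 \<in> G" and card: "card c1 = 5" "card c2 = 5" "card c3 = 5"
    and ne: "c1 \<noteq> c2" "c1 \<noteq> c3" "c2 \<noteq> c3"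
    and meet: "c1 \<inter> c2 \<noteq> {}" "c1 \<inter> c3 \<noteq> {}" and empty: "c1 \<inter> c2 \<inter> c3 = {}"
  shows False
proof -
  define T where "T = c1 \<union> c2 \<union> c3"
  have f: "finite c1" "finite c2" "finite c3" using G finite_gen by auto
  have meet': "c2 \<inter> c1 \<noteq> {}" "c3 \<inter> c1 \<noteq> {}" using meet by (simp_all add: Int_commute)
  have m23: "c2 \<inter> c3 \<noteq> {}"
    by (rule trans_5[OF G card(1) meet'(1) ne(1)[symmetric] meet'(2) ne(2)[symmetric]])
  have m: "card (c1 \<inter> c2) = 1" "card (c1 \<inter> c3) = 1" "card (c2 \<inter> c3) = 1"
    using meet_5(2)[OF G(2) card(2) G(1) meet(1) ne(1)] meet_5(2)[OF G(3) card(3) G(1) meet(2) ne(2)]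
      meet_5(2)[OF G(3) card(3) G(2) m23 ne(3)] by auto
  have u: "card (c1 \<union> c2) = 9" using card_Un_Int[OF f(1,2)] m card by simp
  have "(c1 \<union> c2) \<inter> c3 = (c1 \<inter> c3) \<union> (c2 \<inter> c3)" by auto
  moreover have "card ((c1 \<inter> c3) \<union> (c2 \<inter> c3)) = 2"
    using m empty f by (subst card_Un_disjoint) auto
  ultimately have T: "card T = 12"
    using card_Un_Int[of "c1 \<union> c2" c3] f u card by (simp add: T_def)
  have s: "c1 \<in> xor_span G" "c2 \<in> xor_span G" "c3 \<in> xor_span G" using G xor_span_base by auto
  show False
  proof (cases "\<forall>A\<in>G. A \<subseteq> T \<or> A \<inter> T = {}")
    case True
    have red: "reducible G T (card (c1 \<triangle> c2))"
      by (rule reducible_isolated[OF True])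
        (use s G meet in \<open>auto simp: T_def intro: xor_span_xor\<close>)
    have "card (c1 \<triangle> c2) = 8" using card_xor[of c1 c2] f card m by simp
    with irreducible[OF red] show False using T by (simp add: gains5_def)
  next
    case False
    then obtain d where d: "d \<in> G" "\<not> d \<subseteq> T" "d \<inter> T \<noteq> {}" by blast
    have dne: "d \<noteq> c1" "d \<noteq> c2" "d \<noteq> c3" using d by (auto simp: T_def)
    \<comment> \<open>The new set meets one of the three, and \<open>trans_5\<close> carries this
      over to the others.\<close>
    have md: "d \<inter> c1 \<noteq> {} \<and> d \<inter> c2 \<noteq> {} \<and> d \<inter> c3 \<noteq> {}"
    proof -
      have "d \<inter> c1 \<noteq> {} \<or> d \<inter> c2 \<noteq> {} \<or> d \<inter> c3 \<noteq> {}" using d by (auto simp: T_def)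
      then show ?thesis
        using trans_5[OF G(1) d(1) G(2) card(1) _ dne(1) meet'(1) ne(1)[symmetric]]
          trans_5[OF G(1) d(1) G(3) card(1) _ dne(1) meet'(2) ne(2)[symmetric]]
          trans_5[OF G(2) d(1) G(1) card(2) _ dne(2) meet(1) ne(1)]
          trans_5[OF G(3) d(1) G(1) card(3) _ dne(3) meet(2) ne(2)] by argo
    qed
    have cd: "card d = 5" using meet_5(1)[OF G(1) card(1) d(1)] md dne(1) by simp
    have "card (d \<inter> c1) = 1" "card (d \<inter> c2) = 1" "card (d \<inter> c3) = 1"
      using meet_5(2)[OF G(1) card(1) d(1)] meet_5(2)[OF G(2) card(2) d(1)]
        meet_5(2)[OF G(3) card(3) d(1)] md dne by simp_all
    then obtain p q r where pqr: "d \<inter> c1 = {p}" "d \<inter> c2 = {q}" "d \<inter> c3 = {r}"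
      by (auto simp: card_1_singleton_iff)
    then have "T \<inter> d = {p, q, r}" by (auto simp: T_def)
    \<comment> \<open>The three sets have no common point, so the new set hits the triangle in two
      or three points and enlarges it to 15 or 14.\<close>
    moreover have "\<not> (p = q \<and> q = r)" using pqr empty by auto
    ultimately have "card (T \<inter> d) = 2 \<or> card (T \<inter> d) = 3" by (auto simp: card_insert_if)
    moreover have "card (T \<union> d) + card (T \<inter> d) = 17"
      using card_Un_Int[of T d] f cd T finite_gen[OF d(1)] by (simp add: T_def)
    ultimately have "card (T \<union> d) = 14 \<or> card (T \<union> d) = 15" by auto
    moreover have "T \<union> d = \<Union>{c1, c2, c3, d}" by (auto simp: T_def)
    moreover have "{c1, c2, c3, d} \<subseteq> xor_span G" using s d xor_span_base by auto
    moreover have "\<forall>A\<in>{c1, c2, c3, d}. odd (card A)" using card cd by auto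
    moreover have "\<Inter>{c1, c2, c3, d} = {}" using empty by auto
    ultimately show False
      using not_6_8_14[of "{c1, c2, c3, d}" c1 c1] not_13_15[of "{c1, c2, c3, d}"] card by auto
  qed
qed

lemma no_5:
  assumes c: "c \<in> G"
  shows "card c \<noteq> 5"
proof
  assume card: "card c = 5"
  then obtain x0 where x0: "x0 \<in> c" by fastforce
  obtain c2 where c2: "c2 \<in> G" "c2 \<noteq> c" "\<not> c2 \<inter> c \<subseteq> {x0}"
    using two_points_5[OF c card x0] by blast
  have m2: "card c2 = 5" "card (c2 \<inter> c) = 1" using meet_5[OF c card c2(1) _ c2(2)] c2(3) by auto
  obtain x where x: "c2 \<inter> c = {x}" using m2(2) card_1_singletonE by blast
  then have "x \<in> c" by blast
  \<comment> \<open>Excluding the point \<open>x\<close> already used by \<open>c2\<close> makes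
    \<open>c3\<close> meet \<open>c\<close> in a different point, so a triangle arises.\<close>
  then obtain c3 where c3: "c3 \<in> G" "c3 \<noteq> c" "\<not> c3 \<inter> c \<subseteq> {x}"
    using two_points_5[OF c card] by blast
  have m3: "card c3 = 5" "card (c3 \<inter> c) = 1" using meet_5[OF c card c3(1) _ c3(2)] c3(3) by auto
  obtain y where y: "c3 \<inter> c = {y}" using m3(2) card_1_singletonE by blast
  show False
  proof (rule no_triangle_5[OF c c2(1) c3(1) card m2(1) m3(1) c2(2)[symmetric] c3(2)[symmetric]])
    show "c \<inter> c2 \<noteq> {}" "c \<inter> c3 \<noteq> {}" using x y by auto
    have xy: "x \<noteq> y" using c3(3) y by auto
    then show "c2 \<noteq> c3" using x y by (metis singleton_inject)
    have "c \<inter> c2 \<inter> c3 = (c2 \<inter> c) \<inter> (c3 \<inter> c)" by blast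
    then show "c \<inter> c2 \<inter> c3 = {}" unfolding x y using xy by simp
  qed
qed

section \<open>Excluding generators of sizes two and four\<close>

lemma even_gen:
  assumes "A \<in> G"
  shows "card A \<in> {0, 2, 4}"
proof -
  have "card A \<noteq> 1" "card A \<noteq> 3" using not_1_3_7[of "{A}"] xor_span_base[OF assms] by auto
  moreover have "card A \<in> {0, 1, 2, 3, 4, 5}" using le5[OF assms] by (simp add: numeral_eq_Suc le_Suc_eq)
  ultimately show ?thesis using no_5[OF assms] by auto
qed

text \<open>The union has five coordinates; if isolated, it gains the four ones of \<open>A\<close>.
  A generator crossing its boundary adds one to three points, and the odd intersection of
  \<open>A\<close> and \<open>B\<close> rules out the even sizes 6 and 8. Arbitrary span members are
  allowed because \<open>even_Int_gen\<close> applies this to a sum of two generators.\<close>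

lemma no_meet_4_2:
  assumes A: "A \<in> xor_span G" "card A = 4" and B: "B \<in> xor_span G" "card B = 2"
  shows "card (A \<inter> B) \<noteq> 1"
proof
  assume i: "card (A \<inter> B) = 1"
  define T where "T = A \<union> B"
  have f: "finite A" "finite B" using A B finite_span by auto
  have T: "card T = 5" using card_Un_Int[OF f] A B i by (simp add: T_def)
  show False
  proof (cases "\<forall>d\<in>G. d \<subseteq> T \<or> d \<inter> T = {}")
    case True
    have "T \<noteq> {}" using T by auto
    moreover have "T \<subseteq> \<Union>G"
      using xor_span_subset_Union[OF A(1)] xor_span_subset_Union[OF B(1)] by (simp add: T_def)
    ultimately have red: "reducible G T (card A)"
      by (intro reducible_isolated[OF True A(1)]) (simp_all add: T_def)
    from irreducible[OF red] show False using T A by (simp add: gains5_def)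
  next
    case False
    then obtain d where d: "d \<in> G" "\<not> d \<subseteq> T" "d \<inter> T \<noteq> {}" by blast
    have fd: "finite d" "finite T" using d f finite_gen by (auto simp: T_def)
    have "card (d \<inter> T) > 0" "card (d - T) > 0" using d fd by (auto simp: card_gt_0_iff)
    moreover have "card d = card (d \<inter> T) + card (d - T)" by (rule card_Int_Diff) (use fd in simp)
    moreover have "card d \<le> 4" using even_gen[OF d(1)] by auto
    moreover have "card (T \<union> d) = 5 + card (d - T)"
      using card_Un_disjoint[of T "d - T"] fd T by simp
    ultimately have u: "card (T \<union> d) = 6 \<or> card (T \<union> d) = 7 \<or> card (T \<union> d) = 8" by linarith
    have T': "T \<union> d = \<Union>{A, B, d}" by (auto simp: T_def)
    have "{A, B, d} \<subseteq> xor_span G" using A(1) B(1) xor_span_base[OF d(1)] by simp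
    with not_6_8_14[of "{A, B, d}" A B] not_1_3_7[of "{A, B, d}"] show False
      using u i unfolding T' by simp
  qed
qed

text \<open>No generator can split the pair \<open>B\<close>: one of size 4 contradicts
  \<open>no_meet_4_2\<close>, and one of size 2 would give a union of size 3. So \<open>B\<close> is
  a homogeneous block.\<close>

lemma no_2:
  assumes B: "B \<in> G"
  shows "card B \<noteq> 2"
proof
  assume card: "card B = 2"
  have s: "B \<in> xor_span G" using B xor_span_base by auto
  have f: "finite B" using B finite_gen by auto
  have "B \<subseteq> d \<or> d \<inter> B = {}" if d: "d \<in> G" for d
  proof (rule ccontr)
    assume n: "\<not> (B \<subseteq> d \<or> d \<inter> B = {})"
    have fd: "finite d" using d finite_gen by auto
    have sd: "d \<in> xor_span G" using d xor_span_base by auto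
    have "card (d \<inter> B) > 0" using n fd by (auto simp: card_gt_0_iff)
    moreover have "card (d \<inter> B) < card B" using n f by (intro psubset_card_mono) auto
    ultimately have 1: "card (d \<inter> B) = 1" using card by simp
    have "card d \<in> {0, 2, 4}" using even_gen[OF d] .
    moreover have "card d \<noteq> 4" using no_meet_4_2[OF sd _ s card] 1 by auto
    moreover have "card d \<noteq> 0" using 1 fd by auto
    ultimately have "card d = 2" by simp
    then have "card (\<Union>{d, B}) = 3" using card_Un_Int[OF fd f] 1 card by simp
    moreover have "{d, B} \<subseteq> xor_span G" using s sd by simp
    ultimately show False using not_1_3_7[of "{d, B}"] by simp
  qed
  then have "reducible G B (card B)"
    using B card by (intro reducible_homogeneous) auto
  from irreducible[OF this] show False using card by (simp add: gains5_def)
qed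

text \<open>Both sets have size 4. One common point gives a union of size 7; three common points
  give a sum of size 2 that meets \<open>A\<close> in one point.\<close>

lemma even_Int_gen:
  assumes A: "A \<in> G" and B: "B \<in> G"
  shows "even (card (A \<inter> B))"
proof (rule ccontr)
  assume odd: "odd (card (A \<inter> B))"
  have f: "finite A" "finite B" using A B finite_gen by auto
  have s: "A \<in> xor_span G" "B \<in> xor_span G" using A B xor_span_base by auto
  have le: "card (A \<inter> B) \<le> card A" "card (A \<inter> B) \<le> card B" using f by (auto intro: card_mono)
  have 4: "card A = 4" "card B = 4"
    using even_gen[OF A] even_gen[OF B] no_2[OF A] no_2[OF B] odd le by auto
  then have "card (A \<inter> B) = 1 \<or> card (A \<inter> B) = 3" using odd le by presburger
  then show False
  proof
    assume "card (A \<inter> B) = 1"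
    then have "card (A \<union> B) = 7" using card_Un_Int[OF f] 4 by simp
    then show False using not_1_3_7[of "{A, B}"] s by simp
  next
    assume 3: "card (A \<inter> B) = 3"
    then have "card (A \<triangle> B) = 2" using card_xor[OF f] 4 by simp
    moreover have "A \<inter> (A \<triangle> B) = A - B" by auto
    moreover have "card (A - B) = 1" using card_Int_Diff[OF f(1), of B] 3 4 by simp
    ultimately show False using no_meet_4_2[OF s(1) 4(1) xor_span_xor[OF s]] by simp
  qed
qed

text \<open>The two members \<open>A\<close>, \<open>A'\<close> meet in two points; their Venn diagram consists of three pairs.
  A further member cutting these pairs in one point each would complete a simplex code.\<close>

lemma no_4:
  assumes A: "A \<in> G"
  shows "card A \<noteq> 4"
proof
  assume four: "card A = 4"
  have s: "A \<in> xor_span G" using A xor_span_base by auto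
  have f: "finite A" using A finite_gen by auto
  have ge: "card B = 4" if "B \<in> G" "B \<noteq> {}" for B
    using even_gen[OF that(1)] no_2[OF that(1)] finite_gen[OF that(1)] that(2) by auto
  have "\<not> (\<forall>B\<in>G. B \<subseteq> A \<or> B \<inter> A = {})"
  proof
    assume "\<forall>B\<in>G. B \<subseteq> A \<or> B \<inter> A = {}"
    then have "reducible G A (card A)"
      by (rule reducible_isolated) (use s A four in auto)
    from irreducible[OF this] show False using four by (simp add: gains5_def)
  qed
  then obtain A' where A': "A' \<in> G" "\<not> A' \<subseteq> A" "A' \<inter> A \<noteq> {}" by blast
  have s': "A' \<in> xor_span G" using A' xor_span_base by auto
  have f': "finite A'" using A' finite_gen by auto
  have four': "card A' = 4" using A' ge by auto
  have "card (A \<inter> A') > 0" using A' f by (auto simp: card_gt_0_iff)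
  moreover have "card (A' \<inter> A) < card A'" using A' f' by (intro psubset_card_mono) auto
  ultimately have 2: "card (A \<inter> A') = 2"
    using even_Int_gen[OF A A'(1)] four' by (auto simp: Int_commute elim!: evenE)
  define P where "P = A - A'"
  define Q where "Q = A \<inter> A'"
  define R where "R = A' - A"
  have APQ: "A = P \<union> Q" "A' = Q \<union> R" and disj: "P \<inter> Q = {}" "Q \<inter> R = {}" "P \<inter> R = {}"
    by (auto simp: P_def Q_def R_def)
  have card: "card P = 2" "card Q = 2" "card R = 2"
    using card_Int_Diff[OF f, of A'] card_Int_Diff[OF f', of A] 2 four four'
    by (auto simp: P_def Q_def R_def Int_commute)
  have fp: "finite P" "finite Q" "finite R" using f f' by (auto simp: P_def Q_def R_def)
  have cardU: "card (X \<union> Y) = 4"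
    if "card X = 2" "card Y = 2" "X \<inter> Y = {}" "finite X" "finite Y" for X Y :: "'a set"
    using that by (simp add: card_Un_disjoint)
  define T where "T = P \<union> Q \<union> R"
  have T: "card T = 6"
    using card_Un_disjoint[of "P \<union> Q" R] cardU[of P Q] card disj fp by (auto simp: T_def)
  \<comment> \<open>The even intersections with \<open>A\<close> and \<open>A'\<close> force a set
    that splits one pair to split all three, so the union would have 6 + 4 - 3 = 7 elements.\<close>
  have pair: "S \<subseteq> B \<or> B \<inter> S = {}" if B: "B \<in> G" and S: "S \<in> {P, Q, R}" for B S
  proof (rule ccontr)
    assume n: "\<not> ?thesis"
    have fB: "finite B" using B finite_gen by auto
    have le: "card (B \<inter> S) \<le> 2" if "S \<in> {P, Q, R}" for S
      using that card fp by (metis Int_lower2 card_mono insertE singletonD)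
    have "card (B \<inter> S) > 0" using n fB by (auto simp: card_gt_0_iff)
    moreover have "card (B \<inter> S) < card S" using n S fp by (intro psubset_card_mono) auto
    ultimately have odd: "odd (card (B \<inter> S))" using S card by auto
    have i: "card (B \<inter> A) = card (B \<inter> P) + card (B \<inter> Q)"
      "card (B \<inter> A') = card (B \<inter> Q) + card (B \<inter> R)"
      unfolding APQ Int_Un_distrib using disj fp by (subst card_Un_disjoint; auto)+
    have "odd (card (B \<inter> P)) \<and> odd (card (B \<inter> Q)) \<and> odd (card (B \<inter> R))"
      using odd S i even_Int_gen[OF B A] even_Int_gen[OF B A'(1)] by auto
    then have one: "card (B \<inter> P) = 1" "card (B \<inter> Q) = 1" "card (B \<inter> R) = 1"
      using le[of P] le[of Q] le[of R] by (auto elim!: oddE)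
    have "T \<inter> B = (B \<inter> A) \<union> (B \<inter> R)" using APQ by (auto simp: T_def)
    moreover have "card ((B \<inter> A) \<union> (B \<inter> R)) = 3"
      using one i f fp disj APQ by (subst card_Un_disjoint) auto
    moreover have "card B = 4" using ge[OF B] one by fastforce
    ultimately have "card (T \<union> B) = 7"
      using card_Un_Int[of T B] T fB fp by (simp add: T_def)
    moreover have "T \<union> B = \<Union>{A, A', B}" using APQ by (auto simp: T_def)
    moreover have "{A, A', B} \<subseteq> xor_span G" using s s' B xor_span_base by auto
    ultimately show False using not_1_3_7[of "{A, A', B}"] by auto
  qed
  have "reducible G T 4"
    unfolding reducible_def
  proof (intro conjI ballI)
    show "T \<noteq> {}" using T by auto
    show "T \<subseteq> \<Union>G" using A A' APQ by (auto simp: T_def)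
    fix y assume y: "y \<in> xor_span G"
    have hom: "S \<subseteq> y \<or> y \<inter> S = {}" if "S \<in> {P, Q, R}" for S
      by (rule xor_span_homogeneous[OF _ y]) (use pair that in blast)
    \<comment> \<open>Each pair is wholly in or out of \<open>y\<close>, so two of the three pairs
      agree; if both are out, one of the three nonzero corrections flips exactly these two.\<close>
    have "\<exists>d\<in>{{}, A, A', A \<triangle> A'}. P \<union> Q \<subseteq> y \<triangle> d \<or> Q \<union> R \<subseteq> y \<triangle> d \<or> P \<union> R \<subseteq> y \<triangle> d"
    proof -
      have "P \<subseteq> y \<or> y \<inter> P = {}" "Q \<subseteq> y \<or> y \<inter> Q = {}" "R \<subseteq> y \<or> y \<inter> R = {}"
        using hom by auto
      then consider "P \<union> Q \<subseteq> y \<or> Q \<union> R \<subseteq> y \<or> P \<union> R \<subseteq> y" | "y \<inter> (P \<union> Q) = {}"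
        | "y \<inter> (Q \<union> R) = {}" | "y \<inter> (P \<union> R) = {}"
        by blast
      then show ?thesis
      proof cases
        case 1
        then show ?thesis by simp
      next
        case 2
        then have "P \<union> Q \<subseteq> y \<triangle> A" unfolding APQ xor_def by blast
        then show ?thesis by simp
      next
        case 3
        then have "Q \<union> R \<subseteq> y \<triangle> A'" unfolding APQ xor_def by blast
        then show ?thesis by simp
      next
        case 4
        then have "P \<union> R \<subseteq> y \<triangle> (A \<triangle> A')" unfolding P_def R_def xor_def by blast
        then show ?thesis by simp
      qed
    qed
    then obtain d where d: "d \<in> {{}, A, A', A \<triangle> A'}"
      and S: "P \<union> Q \<subseteq> y \<triangle> d \<or> Q \<union> R \<subseteq> y \<triangle> d \<or> P \<union> R \<subseteq> y \<triangle> d" by blast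
    have dG: "d \<in> xor_span G" using d s s' xor_span.empty xor_span_xor by blast
    have dT: "d \<subseteq> T" using d APQ by (auto simp: T_def)
    obtain S where "S \<subseteq> T \<inter> (y \<triangle> d)" "card S = 4"
    proof -
      have "card (P \<union> Q) = 4" "card (Q \<union> R) = 4" "card (P \<union> R) = 4"
        using cardU card disj fp by auto
      moreover have "P \<union> Q \<subseteq> T" "Q \<union> R \<subseteq> T" "P \<union> R \<subseteq> T" by (auto simp: T_def)
      ultimately show ?thesis using that S by (metis Int_subset_iff)
    qed
    then have "4 \<le> card (T \<inter> (y \<triangle> d))" using fp by (metis card_mono T_def finite_Int finite_Un)
    with dG dT show "\<exists>d\<in>xor_span G. d \<subseteq> T \<and> 4 \<le> card (T \<inter> (y \<triangle> d))" by blast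
  qed
  from irreducible[OF this] show False using T by (simp add: gains5_def)
qed

lemma Union_empty: "\<Union>G = {}"
proof -
  have "A = {}" if "A \<in> G" for A
    using even_gen[OF that] no_2[OF that] no_4[OF that] finite_gen[OF that] by simp
  then show ?thesis by auto
qed

end

lemma exists_reducible5:
  assumes "finite (\<Union>G)" "\<Union>G \<noteq> {}" "\<forall>A\<in>G. card A \<le> 5"
  shows "\<exists>T s. reducible G T s \<and> (card T, s) \<in> gains5"
proof (rule ccontr)
  assume "\<not> ?thesis"
  then interpret irreducible5 G by unfold_locales (use assms in auto)
  show False using Union_empty assms by simp
qed

text \<open>Averaging excludes unions of size 1 and 3, so all nonempty generators are pairs. Two
  overlapping distinct pairs would have a union of size 3, so each pair is homogeneous.\<close>

lemma exists_reducible3: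
  assumes fin: "finite (\<Union>G)" and ne: "\<Union>G \<noteq> {}" and le: "\<forall>A\<in>G. card A \<le> 3"
  shows "\<exists>T s. reducible G T s \<and> (card T, s) \<in> {(1,1), (2,2), (3,2)}"
proof (rule ccontr)
  assume n: "\<not> ?thesis"
  have f: "finite A" if "A \<in> G" for A using that fin by (meson Union_upper finite_subset)
  have avg: "card (\<Union>F) \<noteq> 1" "card (\<Union>F) \<noteq> 3" if "F \<subseteq> G" for F
  proof -
    have "F \<subseteq> xor_span G" using that xor_span_base by auto
    then show "card (\<Union>F) \<noteq> 1" "card (\<Union>F) \<noteq> 3"
      using reducible_average[OF fin, of F] n by fastforce+
  qed
  have two: "card A = 2" if "A \<in> G" "A \<noteq> {}" for A
    using avg[of "{A}"] that le f[of A] by (auto simp: le_Suc_eq numeral_3_eq_3)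
  obtain B where B: "B \<in> G" "B \<noteq> {}" using ne by auto
  have "B \<subseteq> d \<or> d \<inter> B = {}" if d: "d \<in> G" for d
  proof (rule ccontr)
    assume h: "\<not> (B \<subseteq> d \<or> d \<inter> B = {})"
    have "card (d \<inter> B) > 0" using h f[OF B(1)] by (auto simp: card_gt_0_iff)
    moreover have "card (d \<inter> B) < card B" using h f[OF B(1)] by (intro psubset_card_mono) auto
    moreover have "card d = 2" "card B = 2" using two d B h by auto
    ultimately have "card (d \<union> B) = 3" using card_Un_Int[OF f[OF d] f[OF B(1)]] by simp
    then show False using avg[of "{d, B}"] d B by auto
  qed
  then have "reducible G B (card B)" using B by (intro reducible_homogeneous) auto
  then show False using n two[OF B] by auto
qed

lemma exists_reducible1:
  assumes "finite (\<Union>G)" "\<Union>G \<noteq> {}" "\<forall>A\<in>G. card A \<le> 1"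
  shows "\<exists>T s. reducible G T s \<and> (card T, s) \<in> {(1,1)}"
proof -
  obtain A where A: "A \<in> G" "A \<noteq> {}" using assms by auto
  have "finite A" using A assms(1) by (meson Union_upper finite_subset)
  then have 1: "card A = 1" using A assms(3) by (metis One_nat_def card_gt_0_iff le_antisym Suc_leI)
  have "{A} \<subseteq> xor_span G" using A xor_span_base by auto
  then have "reducible G (\<Union>{A}) ((card (\<Union>{A}) + 1) div 2)"
    by (rule reducible_average[OF assms(1)]) (use A in auto)
  then show ?thesis using 1 by (intro exI[of _ A]) auto
qed

section \<open>Column spaces of matrices\<close>

definition supp :: "bit vec \<Rightarrow> nat set" where
  "supp v = {i. i < dim_vec v \<and> v $ i = 1}"

lemma weight_eq_card_supp: "weight v = card (supp v)"
  by (simp add: weight_def supp_def)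

lemma supp_add: "dim_vec u = dim_vec v \<Longrightarrow> supp (u + v) = supp u \<triangle> supp v"
  by (auto simp: supp_def)

lemma mult_unit_vec:
  assumes "W \<in> carrier_mat n n" "j < n"
  shows "W *\<^sub>v unit_vec n j = (col W j :: bit vec)"
  using assms by (intro eq_vecI) auto

lemma supp_mult_zero_vec: "W \<in> carrier_mat n n \<Longrightarrow> supp (W *\<^sub>v 0\<^sub>v n) = {}"
  by (auto simp: supp_def)

lemma supp_mult_mat_vec:
  assumes W: "W \<in> carrier_mat n n"
  shows "{supp (W *\<^sub>v x) | x. x \<in> carrier_vec n} = xor_span ((\<lambda>j. supp (col W j)) ` {..<n})"
    (is "?L = xor_span ?G")
proof
  show "?L \<subseteq> xor_span ?G"
  proof safe
    fix x :: "bit vec" assume x: "x \<in> carrier_vec n"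
    \<comment> \<open>Truncating \<open>x\<close> after \<open>k\<close> entries allows the columns
      to be added one at a time.\<close>
    define t where "t k = vec n (\<lambda>i. if i < k then x $ i else 0)" for k
    have "supp (W *\<^sub>v t k) \<in> xor_span ?G" if "k \<le> n" for k
      using that
    proof (induction k)
      case 0
      have "t 0 = 0\<^sub>v n" by (auto simp: t_def)
      then show ?case using supp_mult_zero_vec[OF W] xor_span.empty by simp
    next
      case (Suc k)
      show ?case
      proof (cases "x $ k = 1")
        case True
        have "t (Suc k) = unit_vec n k + t k"
          using True by (intro eq_vecI) (auto simp: t_def less_Suc_eq unit_vec_def)
        moreover have "t k \<in> carrier_vec n" by (simp add: t_def)
        ultimately have "W *\<^sub>v t (Suc k) = col W k + W *\<^sub>v t k"
          using W Suc.prems mult_unit_vec[OF W, of k]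
          by (simp add: mult_add_distrib_mat_vec[OF W unit_vec_carrier])
        then have "supp (W *\<^sub>v t (Suc k)) = supp (col W k) \<triangle> supp (W *\<^sub>v t k)"
          using W by (simp add: supp_add)
        then show ?thesis using Suc by (auto intro!: xor_span.step)
      next
        case False
        then have "t (Suc k) = t k"
          by (intro eq_vecI) (auto simp: t_def less_Suc_eq)
        then show ?thesis using Suc by simp
      qed
    qed
    moreover have "t n = x" using x by (intro eq_vecI) (auto simp: t_def)
    ultimately show "supp (W *\<^sub>v x) \<in> xor_span ?G" by (metis order_refl)
  qed
  show "xor_span ?G \<subseteq> ?L"
  proof
    fix y assume "y \<in> xor_span ?G"
    then show "y \<in> ?L"
    proof induction
      case empty
      show ?case using supp_mult_zero_vec[OF W] zero_carrier_vec by blast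
    next
      case (step A y)
      then obtain j x where j: "j < n" "A = supp (col W j)"
        and x: "x \<in> carrier_vec n" "y = supp (W *\<^sub>v x)" by auto
      have "A \<triangle> y = supp (W *\<^sub>v (unit_vec n j + x))"
        using W j x mult_unit_vec[OF W j(1)]
        by (simp add: mult_add_distrib_mat_vec[OF W unit_vec_carrier] supp_add)
      moreover have "unit_vec n j + x \<in> carrier_vec n" using x by simp
      ultimately show ?case by blast
    qed
  qed
qed

lemma M0_eq_Max_card:
  assumes W: "W \<in> carrier_mat n n"
  shows "M0 W = Max (card ` xor_span ((\<lambda>j. supp (col W j)) ` {..<n}))"
proof -
  have "{weight (W *\<^sub>v x) | x. x \<in> carrier_vec (dim_col W)} =
      card ` {supp (W *\<^sub>v x) | x. x \<in> carrier_vec n}"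
    using W by (auto simp: weight_eq_card_supp)
  then show ?thesis by (simp add: M0_def supp_mult_mat_vec[OF W])
qed

lemma finite_Union_supp: "finite (\<Union>((\<lambda>j. supp (col W j)) ` {..<n}))"
  by (auto simp: supp_def)

lemma \<mu>_ge:
  assumes "1 \<le> m" "g 0 = 0"
    and "\<And>G :: nat set set. finite (\<Union>G) \<Longrightarrow> \<Union>G \<noteq> {} \<Longrightarrow> \<forall>A\<in>G. card A \<le> m \<Longrightarrow>
      \<exists>T s. reducible G T s \<and> (card T, s) \<in> P"
    and "\<And>n t s. (t, s) \<in> P \<Longrightarrow> t \<le> n \<Longrightarrow> g n \<le> g (n - t) + s"
  shows "g n \<le> \<mu> n m"
proof -
  have "\<mu> n m \<in> {M0 W | W. W \<in> A_set n m}"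
    unfolding \<mu>_def by (rule Min_in[OF finite_\<mu>_set nonempty_\<mu>_set[OF assms(1)]])
  then obtain W where W: "W \<in> A_set n m" "\<mu> n m = M0 W" by blast
  have Wc: "W \<in> carrier_mat n n" using W by (simp add: A_set_def)
  define G where "G = (\<lambda>j. supp (col W j)) ` {..<n}"
  have fin: "finite (\<Union>G)" unfolding G_def by (rule finite_Union_supp)
  \<comment> \<open>The ones on the diagonal put every index into the support of its own
    column.\<close>
  have UG: "\<Union>G = {..<n}" using W(1) by (auto simp: G_def A_set_def supp_def)
  have le: "\<forall>A\<in>G. card A \<le> m"
    using W(1) by (auto simp: G_def A_set_def weight_eq_card_supp)
  have "\<exists>y\<in>xor_span G. g (card (\<Union>G)) \<le> card y"
    by (rule exists_heavy[OF assms(3,4,2) fin le])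
  then obtain y where y: "y \<in> xor_span G" "g n \<le> card y" unfolding UG card_lessThan by blast
  have "card y \<le> Max (card ` xor_span G)"
    using y(1) by (intro Max_ge finite_imageI finite_xor_span[OF fin] imageI)
  then show ?thesis using y(2) W(2) by (simp add: M0_eq_Max_card[OF Wc] G_def)
qed

text \<open>The family may have fewer than \<open>n\<close> members; \<open>\<mu>_le\<close> repeats
  them as columns.\<close>

definition achieves :: "nat \<Rightarrow> nat \<Rightarrow> nat \<Rightarrow> bool" where
  "achieves m n b \<longleftrightarrow>
    (\<exists>G. \<Union>G = {..<n} \<and> (\<forall>A\<in>G. card A \<le> m) \<and> (\<forall>y\<in>xor_span G. card y \<le> b))"

text \<open>Column \<open>j\<close> is any member of the family containing \<open>j\<close>, which
  puts a one on the diagonal; the column space then lies in the span of the family.\<close>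

lemma \<mu>_le:
  assumes "achieves m n b"
  shows "\<mu> n m \<le> b"
proof -
  obtain G where G: "\<Union>G = {..<n}" "\<forall>A\<in>G. card A \<le> m" "\<forall>y\<in>xor_span G. card y \<le> b"
    using assms by (auto simp: achieves_def)
  have "\<forall>i. \<exists>A. i < n \<longrightarrow> A \<in> G \<and> i \<in> A" using G(1) by (metis UnionE lessThan_iff)
  then obtain f where f: "f i \<in> G" "i \<in> f i" if "i < n" for i by metis
  define W :: "bit mat" where "W = mat n n (\<lambda>(i, j). of_bool (i \<in> f j))"
  have Wc: "W \<in> carrier_mat n n" by (simp add: W_def)
  have col: "supp (col W j) = f j" if "j < n" for j
  proof -
    have "f j \<subseteq> {..<n}" using f[OF that] G(1) by blast
    then show ?thesis using that by (auto simp: supp_def W_def)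
  qed
  have "W \<in> A_set n m"
    using f G(2) col Wc by (auto simp: A_set_def weight_eq_card_supp) (simp add: W_def)
  then have "\<mu> n m \<le> M0 W" unfolding \<mu>_def by (intro Min_le finite_\<mu>_set) blast
  also have "M0 W \<le> b"
  proof -
    have "(\<lambda>j. supp (col W j)) ` {..<n} \<subseteq> xor_span G"
      using col f by (auto intro: xor_span_base)
    from xor_span_minimal[OF this] show ?thesis
      using G(3) finite_xor_span[OF finite_Union_supp] xor_span.empty
      by (subst M0_eq_Max_card[OF Wc], subst Max_le_iff) blast+
  qed
  finally show ?thesis .
qed

section \<open>Upper bounds from explicit codes and direct sums\<close>

lemma achieves_mono: "achieves m n b \<Longrightarrow> m \<le> m' \<Longrightarrow> achieves m' n b"
  unfolding achieves_def by (meson order_trans)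

lemma achieves_0: "achieves m 0 0"
proof -
  have "y = {}" if "y \<in> xor_span {}" for y :: "nat set" using that by induction auto
  then show ?thesis unfolding achieves_def by (intro exI[of _ "{}"]) fastforce
qed

text \<open>Direct sum: the second family is shifted by \<open>n\<close>, and every member of the
  joint span splits into two parts.\<close>

lemma achieves_add:
  assumes "achieves m n b" "achieves m n' b'"
  shows "achieves m (n + n') (b + b')"
proof -
  obtain G where G: "\<Union>G = {..<n}" "\<forall>A\<in>G. card A \<le> m" "\<forall>y\<in>xor_span G. card y \<le> b"
    using assms(1) by (auto simp: achieves_def)
  obtain H where H: "\<Union>H = {..<n'}" "\<forall>A\<in>H. card A \<le> m" "\<forall>y\<in>xor_span H. card y \<le> b'"
    using assms(2) by (auto simp: achieves_def)
  define K where "K = G \<union> (\<lambda>A. (+) n ` A) ` H"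
  have "\<Union>K = {..<n} \<union> (+) n ` (\<Union>H)" using G by (auto simp: K_def)
  then have UK: "\<Union>K = {..<n + n'}"
    using ivl_disj_un_two(3)[of 0 n "n + n'"] by (simp add: H lessThan_atLeast0 add.commute)
  have KK: "\<forall>A\<in>K. card A \<le> m" using G H by (auto simp: K_def card_image)
  have "\<exists>u\<in>xor_span G. \<exists>v\<in>xor_span H. y = u \<triangle> (+) n ` v" if "y \<in> xor_span K" for y
    using that
  proof induction
    case empty
    show ?case by (intro bexI[OF _ xor_span.empty]) simp
  next
    case (step A y)
    then obtain u v where uv: "u \<in> xor_span G" "v \<in> xor_span H" "y = u \<triangle> (+) n ` v" by blast
    from step.hyps(1) consider "A \<in> G" | B where "B \<in> H" "A = (+) n ` B" by (auto simp: K_def)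
    then show ?case
    proof cases
      case 1
      then have "A \<triangle> u \<in> xor_span G" using uv xor_span.step by blast
      then show ?thesis using uv xor_assoc by metis
    next
      case 2
      then have "B \<triangle> v \<in> xor_span H" using uv xor_span.step by blast
      moreover have "(+) n ` (B \<triangle> v) = (+) n ` B \<triangle> (+) n ` v"
        by (simp add: xor_def image_Un image_set_diff)
      then have "A \<triangle> y = u \<triangle> (+) n ` (B \<triangle> v)" using 2 uv by auto
      ultimately show ?thesis using uv by blast
    qed
  qed
  moreover have "card (u \<triangle> (+) n ` v) \<le> b + b'" if "u \<in> xor_span G" "v \<in> xor_span H" for u v
  proof -
    have "finite u" "finite v"
      using that xor_span_subset_Union G H by (metis finite_lessThan finite_subset)+
    then have "card (u \<triangle> (+) n ` v) \<le> card u + card v"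
      using card_xor[of u "(+) n ` v"] by (simp add: card_image)
    then show ?thesis using G(3) H(3) that by fastforce
  qed
  ultimately show ?thesis unfolding achieves_def using UK KK by (intro exI[of _ K]) blast
qed

lemma achieves_mult: "achieves m n b \<Longrightarrow> achieves m (q * n) (q * b)"
  by (induction q) (auto simp: achieves_0 intro: achieves_add)

text \<open>Closure of \<open>Q\<close> under adding generators traps the span in \<open>Q\<close>,
  which reduces concrete cases to evaluation.\<close>

lemma achieves_explicit:
  assumes "\<Union>G = {..<n}" "\<forall>A\<in>G. card A \<le> m" "{} \<in> Q" "\<forall>A\<in>G. \<forall>X\<in>Q. A \<triangle> X \<in> Q"
    and "\<forall>X\<in>Q. card X \<le> b"
  shows "achieves m n b"
proof -
  have "y \<in> Q" if "y \<in> xor_span G" for y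
    using that by induction (use assms in auto)
  then show ?thesis using assms(1,2,5) unfolding achieves_def by (intro exI[of _ G]) simp
qed

lemma achieves_1: "1 \<le> m \<Longrightarrow> achieves m 1 1"
  by (erule achieves_mono[rotated], rule achieves_explicit[of "{{0}}" _ _ "{{}, {0}}"]; code_simp)

lemma achieves_3: "2 \<le> m \<Longrightarrow> achieves m 3 2"
  by (erule achieves_mono[rotated],
      rule achieves_explicit[of "{{0,1}, {1,2}}" _ _ "{{}, {0,1}, {1,2}, {0,2}}"]; code_simp)

text \<open>The second family below is the simplex code of length 7, generated by the first.\<close>

lemma achieves_7: "4 \<le> m \<Longrightarrow> achieves m 7 4"
  by (erule achieves_mono[rotated],
      rule achieves_explicit[of "{{0,2,4,6}, {1,2,5,6}, {3,4,5,6}}" _ _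
        "{{}, {0,2,4,6}, {1,2,5,6}, {3,4,5,6}, {0,1,4,5}, {0,2,3,5}, {1,2,3,4}, {0,1,3,6}}"];
      code_simp)

section \<open>Values of \<open>U\<close> and the comparison of both bounds\<close>

lemma a_seq_values:
  "a_seq 1 = 1" "a_seq 2 = 2" "a_seq 3 = 2" "a_seq 4 = 3" "a_seq 5 = 4" "a_seq 6 = 4" "a_seq 7 = 4"
proof -
  show 1: "a_seq 1 = 1" by (rule a_seq.simps)
  show 2: "a_seq 2 = 2" using a_seq.simps(3)[of 1 1] 1 by (simp add: numeral_2_eq_2)
  show 3: "a_seq 3 = 2" using a_seq.simps(4)[of 1] by simp
  show "a_seq 4 = 3" using a_seq.simps(3)[of 2 1] 1 by simp
  show "a_seq 5 = 4" using a_seq.simps(3)[of 2 2] 2 by simp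
  show "a_seq 6 = 4" using a_seq.simps(3)[of 2 3] 3 by simp
  show "a_seq 7 = 4" using a_seq.simps(4)[of 2] by simp
qed

lemma U_1: "1 \<le> n \<Longrightarrow> U n 1 = n"
  using U_eq[of 0 1 1 n "n - 1"] a_seq_values by simp

lemma U_2_3:
  assumes "2 \<le> m" "m \<le> 3" "1 \<le> r" "r \<le> 3"
  shows "U (3 * q + r) m = 2 * q + a_seq r"
  using U_eq[of 1 m r "3 * q + r" q] assms by simp

lemma U_4_5:
  assumes "4 \<le> m" "m \<le> 5" "1 \<le> r" "r \<le> 7"
  shows "U (7 * q + r) m = 4 * q + a_seq r"
  using U_eq[of 2 m r "7 * q + r" q] assms by simp

text \<open>A closed form of \<open>U n m\<close> for \<open>m\<close> equal to 4 or 5 that extends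
  to \<open>n = 0\<close>, as the induction needs. Remainder 7 in \<open>U\<close> becomes remainder
  0 of the next block, consistently with \<open>a_seq 7 = 4\<close>.\<close>

definition g7 :: "nat \<Rightarrow> nat" where
  "g7 n = 4 * (n div 7) + n mod 7 - n mod 7 div 3"

lemma g7_add: "g7 (7 * a + c) = 4 * a + g7 c"
proof -
  have "c mod 7 div 3 \<le> c mod 7" by simp
  then show ?thesis by (simp add: g7_def add.assoc)
qed

text \<open>By \<open>g7_add\<close> full blocks of seven cancel, which leaves finitely many
  cases.\<close>

lemma g7_gain:
  assumes "(t, s) \<in> gains5" "t \<le> n"
  shows "g7 n \<le> g7 (n - t) + s"
proof -
  define a where "a = (n - t) div 7"
  define b where "b = (n - t) mod 7"
  have nt: "n - t = 7 * a + b" by (simp add: a_def b_def)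
  then have n: "n = 7 * a + (b + t)" using assms(2) by simp
  have "b < 7" by (simp add: b_def)
  then consider "b = 0" | "b = 1" | "b = 2" | "b = 3" | "b = 4" | "b = 5" | "b = 6" by linarith
  then have "g7 (b + t) \<le> g7 b + s"
    by cases (use assms(1) in \<open>auto simp: gains5_def g7_def\<close>)
  then show ?thesis unfolding nt by (subst n) (simp only: g7_add)
qed

lemma interval_remainder:
  fixes n N :: nat
  assumes "1 \<le> n" "1 \<le> N"
  obtains q r where "n = N * q + r" "1 \<le> r" "r \<le> N"
proof
  show "n = N * ((n - 1) div N) + ((n - 1) mod N + 1)" using assms by simp
  show "(n - 1) mod N + 1 \<le> N" using assms by (simp add: Suc_le_eq)
qed simp

lemma \<mu>_1:
  assumes "1 \<le> n"
  shows "\<mu> n 1 = U n 1"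
proof (rule antisym)
  have "achieves 1 (n * 1) (n * 1)" by (intro achieves_mult achieves_1) simp
  then show "\<mu> n 1 \<le> U n 1" using assms by (simp add: U_1 \<mu>_le del: One_nat_def)
  have "id n \<le> \<mu> n 1"
  proof (rule \<mu>_ge[where P = "{(1,1)}"])
    show "\<exists>T s. reducible G T s \<and> (card T, s) \<in> {(1,1)}"
      if "finite (\<Union>G)" "\<Union>G \<noteq> {}" "\<forall>A\<in>G. card A \<le> 1" for G :: "nat set set"
      using that by (rule exists_reducible1)
  qed auto
  then show "U n 1 \<le> \<mu> n 1" using assms by (simp add: U_1 del: One_nat_def)
qed

lemma \<mu>_2_3:
  assumes "2 \<le> m" "m \<le> 3" "1 \<le> n"
  shows "\<mu> n m = U n m"
proof -
  obtain q r where n: "n = 3 * q + r" and r: "1 \<le> r" "r \<le> 3"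
    by (rule interval_remainder[of n 3]) (use assms in auto)
  have U: "U n m = 2 * q + a_seq r" unfolding n by (rule U_2_3[OF assms(1,2) r])
  have r_cases: "r = 1 \<or> r = 2 \<or> r = 3" using r by linarith
  show ?thesis
  proof (rule antisym)
    have a1: "achieves m 1 1" and a3: "achieves m 3 2"
      using assms by (auto intro: achieves_1[simplified] achieves_3)
    have "achieves m r (a_seq r)"
      using r_cases a1 a3 achieves_add[OF a1 a1]
      by (elim disjE) (simp_all only: a_seq_values one_add_one)
    from achieves_add[OF achieves_mult[OF a3, of q] this] show "\<mu> n m \<le> U n m"
      unfolding U unfolding n by (intro \<mu>_le) (simp add: mult.commute)
    \<comment> \<open>This is the closed form of \<open>U n m\<close> for \<open>m\<close> equal to
      2 or 3.\<close>
    have "n - n div 3 \<le> \<mu> n m"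
    proof (rule \<mu>_ge[where P = "{(1,1), (2,2), (3,2)}"])
      show "\<exists>T s. reducible G T s \<and> (card T, s) \<in> {(1,1), (2,2), (3,2)}"
        if "finite (\<Union>G)" "\<Union>G \<noteq> {}" "\<forall>A\<in>G. card A \<le> m" for G :: "nat set set"
        by (rule exists_reducible3) (use that assms in \<open>auto intro: order_trans\<close>)
      show "n - n div 3 \<le> (n - t) - (n - t) div 3 + s"
        if "(t, s) \<in> {(1, 1), (2, 2), (3, 2)}" "t \<le> n" for n t s :: nat
        using that by auto
    qed (use assms in auto)
    moreover have "n - n div 3 = U n m"
      unfolding U unfolding n using r_cases
      by (auto simp: a_seq_values a_seq_values(1)[unfolded One_nat_def])
    ultimately show "U n m \<le> \<mu> n m" by simp
  qed
qed

lemma \<mu>_4_5: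
  assumes "4 \<le> m" "m \<le> 5" "1 \<le> n"
  shows "\<mu> n m = U n m"
proof -
  obtain q r where n: "n = 7 * q + r" and r: "1 \<le> r" "r \<le> 7"
    by (rule interval_remainder[of n 7]) (use assms in auto)
  have U: "U n m = 4 * q + a_seq r" unfolding n by (rule U_4_5[OF assms(1,2) r])
  have r_cases: "r = 1 \<or> r = 2 \<or> r = 3 \<or> r = 4 \<or> r = 5 \<or> r = 6 \<or> r = 7" using r by linarith
  show ?thesis
  proof (rule antisym)
    have a: "achieves m 1 1" "achieves m 3 2" "achieves m 7 4"
      using assms by (auto intro: achieves_1[simplified] achieves_3 achieves_7)
    \<comment> \<open>The lengths decompose as 2 = 1 + 1, 4 = 3 + 1, 5 = 3 + 1 + 1 and 6 = 3 +
      3.\<close>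
    have "achieves m 2 2" "achieves m 4 3" "achieves m 5 4" "achieves m 6 4"
      using achieves_add[OF a(1) a(1)] achieves_add[OF a(2) a(1)] achieves_add[OF a(2) a(2)]
        achieves_add[OF a(2) achieves_add[OF a(1) a(1)]] by (simp_all add: eval_nat_numeral)
    then have "achieves m r (a_seq r)"
      using r_cases a by (elim disjE) (simp_all only: a_seq_values)
    from achieves_add[OF achieves_mult[OF a(3), of q] this] show "\<mu> n m \<le> U n m"
      unfolding U unfolding n by (intro \<mu>_le) (simp add: mult.commute)
    have "g7 n \<le> \<mu> n m"
    proof (rule \<mu>_ge[where P = gains5])
      show "1 \<le> m" "g7 0 = 0" using assms by (auto simp: g7_def)
      show "\<exists>T s. reducible G T s \<and> (card T, s) \<in> gains5"
        if "finite (\<Union>G)" "\<Union>G \<noteq> {}" "\<forall>A\<in>G. card A \<le> m" for G :: "nat set set"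
        by (rule exists_reducible5) (use that assms in \<open>auto intro: order_trans\<close>)
    qed (rule g7_gain)
    moreover have "g7 n = U n m"
      unfolding U unfolding n g7_add using r_cases
      by (auto simp: a_seq_values a_seq_values(1)[unfolded One_nat_def] g7_def)
    ultimately show "U n m \<le> \<mu> n m" by simp
  qed
qed

theorem theorem6p1:
  fixes n m :: nat
  assumes "1 \<le> m" and "m \<le> 5" and "1 \<le> n"
  shows "\<mu> n m = U n m"
proof -
  consider "m = 1" | "2 \<le> m" "m \<le> 3" | "4 \<le> m" using assms(1) by linarith
  then show ?thesis
  proof cases
    case 1
    then show ?thesis using \<mu>_1[OF assms(3)] by simp
  qed (use assms \<mu>_2_3 \<mu>_4_5 in auto)
qed

end
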